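(* Let $k$ and $l$ be two positive integers. Then $$\mathrm{WS}_2(k,l)=\begin{cases} l+1 & \text{if } k=1 \text{ and } l\equiv 0 \text{ or } 1 \pmod 4,\\ l & \text{if } k=1 \text{ and } l\equiv 2\text{ or } 3 \pmod 4,\\ 2(k-1)l+1 & \text{if } k\geq 2 \text{ and } l \text{ is even},\\ k(l+1) & \text{if } k\geq 2 \text{ and } l\equiv 1 \pmod 4,\\ k(l+1) & \text{if } k\geq 2 \text{ is even and } l\equiv 3 \pmod 4,\\ k(l+1)-1 & \text{if } k\geq 3 \text{ is odd and } l\equiv 3 \pmod 4. \end{cases}$$
   Context: Let $k,l,m$ be positive integers. A set of integers is called weakly $l$-sum-free modulo $m$ if it contains no pairwise distinct elements $x_1,\ldots,x_l,y$ (that is, $l+1$ pairwise distinct integers) satisfying $x_1+\cdots+x_l\equiv y \pmod m$. A $k$-partition of a set $S$ is a family $S_1,\ldots,S_k$ of subsets of $S$ (possibly empty) such that every element of $S$ is contained in exactly one of them. The generalized weak Schur number modulo $m$, denoted $\mathrm{WS}_m(k,l)$, is the largest integer $n$ for which the set $\{1,2,\ldots,n\}$ admits a $k$-partition into sets that are weakly $l$-sum-free modulo $m$. *)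

theory Defs
  imports Main "HOL-Number_Theory.Cong"
begin

definition weakly_sum_free_mod :: "nat \<Rightarrow> nat \<Rightarrow> int set \<Rightarrow> bool" where
  "weakly_sum_free_mod m l A \<longleftrightarrow>
     \<not> (\<exists>(x :: nat \<Rightarrow> int) y.
          x ` {1..l} \<subseteq> A \<and> y \<in> A \<and>
          inj_on x {1..l} \<and> y \<notin> x ` {1..l} \<and>
          [(\<Sum>i=1..l. x i) = y] (mod int m))"

text \<open>
  The family is indexed by \<open>{1..k}\<close>, so empty parts are allowed (possibly several of them);
  values of \<open>P\<close> outside \<open>{1..k}\<close> are irrelevant.
\<close>

definition is_k_partition :: "nat \<Rightarrow> 'a set \<Rightarrow> (nat \<Rightarrow> 'a set) \<Rightarrow> bool" where
  "is_k_partition k S P \<longleftrightarrow>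
     (\<forall>i\<in>{1..k}. P i \<subseteq> S) \<and> (\<forall>s\<in>S. \<exists>!i. i \<in> {1..k} \<and> s \<in> P i)"

text \<open>
  Restricting to natural \<open>n\<close> loses nothing, as \<open>n = 0\<close> always has the required partition.
  If there is no largest such \<open>n\<close>, the value is unspecified.
\<close>

definition WS :: "nat \<Rightarrow> nat \<Rightarrow> nat \<Rightarrow> nat" where
  "WS m k l =
     (GREATEST n. \<exists>P. is_k_partition k {1..int n} P \<and>
                      (\<forall>i\<in>{1..k}. weakly_sum_free_mod m l (P i)))"

end

theory Submission
  imports Defs
begin

text \<open>
  Modulo \<open>2\<close> signs do not matter, so \<open>x\<^sub>1 + \<dots> + x\<^sub>l \<equiv> y\<close> says that the \<open>l + 1\<close> distinct elements
  \<open>x\<^sub>1, \<dots>, x\<^sub>l, y\<close> have an even sum. Hence a set is weakly \<open>l\<close>-sum-free modulo \<open>2\<close> exactly when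
  each of its subsets of size \<open>l + 1\<close> contains an odd number of odd elements. In a set with at least
  \<open>l + 2\<close> elements one element of such a subset can be exchanged for any other element, so all
  elements have the same parity, and this is possible only if they are all odd and \<open>l\<close> is even.
  This yields the classification \<open>weakly_sum_free_mod_2_iff\<close>: apart from sets of at most \<open>l\<close>
  elements, the only sum-free sets are those with \<open>l + 1\<close> elements of which an odd number are odd
  and, if \<open>l\<close> is even, the sets of odd numbers.

  If \<open>l\<close> is odd, all \<open>k\<close> parts therefore have at most \<open>l + 1\<close> elements. When \<open>k (l + 1)\<close> numbers are
  partitioned, all parts are full and have an odd number of odd elements, so that the number
  \<open>k (l + 1) / 2\<close> of odd elements has the parity of \<open>k\<close>; this fails precisely if \<open>l \<equiv> 3 (mod 4)\<close> and
  \<open>k\<close> is odd. Otherwise consecutive blocks of length \<open>l + 1\<close> form a partition if \<open>l \<equiv> 1 (mod 4)\<close>,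
  and the same blocks, paired up and with an even and an odd number exchanged within each pair,
  if \<open>l \<equiv> 3 (mod 4)\<close>.

  If \<open>k = 1\<close>, the single part \<open>{1, \<dots>, n}\<close> contains \<open>2\<close> as soon as \<open>n \<ge> 2\<close>, so \<open>n \<le> l + 1\<close> for every
  \<open>l\<close>, and \<open>n = l + 1\<close> is possible precisely if \<open>{1, \<dots>, l + 1}\<close> has an odd number of odd elements.

  If \<open>l\<close> is even and \<open>k \<ge> 2\<close>, the best use of the parts is to put all odd numbers into one of them
  and \<open>l\<close> even numbers into each of the others. No part can hold more than \<open>l\<close> even numbers, so
  nothing is gained as long as some part has no even element; and if every part has one, then all
  parts have at most \<open>l + 1\<close> elements and \<open>n \<le> k (l + 1)\<close>, which exceeds \<open>2 (k - 1) l + 1\<close> only for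
  \<open>k = 2\<close>, where the parity of the number of odd elements excludes the extra value.
\<close>

section \<open>Sum-free sets modulo two\<close>

text \<open>
  As \<open>y \<equiv> - y (mod 2)\<close>, the element \<open>y\<close> plays the same role as the \<open>x\<^sub>i\<close>, so only the set of all
  \<open>l + 1\<close> elements matters, and the parity of its sum is that of its number of odd elements.
\<close>

lemma weakly_sum_free_mod_2_iff_subsets:
  "weakly_sum_free_mod 2 l A \<longleftrightarrow> (\<forall>T\<subseteq>A. card T = l + 1 \<longrightarrow> odd (card {x\<in>T. odd x}))"
proof -
  have "(\<exists>(x :: nat \<Rightarrow> int) y. x ` {1..l} \<subseteq> A \<and> y \<in> A \<and> inj_on x {1..l} \<and> y \<notin> x ` {1..l} \<and>
          [(\<Sum>i=1..l. x i) = y] (mod int 2))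
    \<longleftrightarrow> (\<exists>T\<subseteq>A. card T = l + 1 \<and> even (card {x\<in>T. odd x}))" (is "?L \<longleftrightarrow> ?R")
  proof
    assume ?L
    then obtain x y where xy: "x ` {1..l} \<subseteq> A" "y \<in> A" "inj_on x {1..l}" "y \<notin> x ` {1..l}"
      and cong: "[(\<Sum>i=1..l. x i) = y] (mod int 2)" by blast
    let ?T = "insert y (x ` {1..l})"
    have "sum id ?T = y + (\<Sum>i=1..l. x i)"
      using xy by (simp add: sum.reindex)
    moreover have "even (y + (\<Sum>i=1..l. x i))"
      using cong by (simp add: cong_def) presburger
    ultimately have "even (sum id ?T)" by metis
    then have "even (card {x\<in>?T. odd x})"
      by (subst (asm) even_sum_iff) auto
    moreover have "card ?T = l + 1"
      using xy by (simp add: card_image)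
    ultimately show ?R using xy by (intro exI[of _ ?T]) auto
  next
    assume ?R
    then obtain T where T: "T \<subseteq> A" "card T = l + 1" "even (card {x\<in>T. odd x})" by blast
    then have fin: "finite T" by (intro card_ge_0_finite) simp
    obtain y where y: "y \<in> T" using T(2) by fastforce
    have c: "card (T - {y}) = l" using T y fin by simp
    obtain x where x: "bij_betw x {1..l} (T - {y})"
      using ex_bij_betw_nat_finite_1[of "T - {y}"] fin c by auto
    have "(\<Sum>i=1..l. x i) = sum id (T - {y})"
      using sum.reindex_bij_betw[OF x, of id] by simp
    also have "\<dots> = sum id T - y"
      using fin y by (simp add: sum_diff1)
    finally have "(\<Sum>i=1..l. x i) = sum id T - y" .
    moreover have "even (sum id T)"
      using T(3) fin by (simp add: even_sum_iff)
    ultimately have "[(\<Sum>i=1..l. x i) = y] (mod int 2)"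
      by (simp add: cong_def) presburger
    then show ?L
      using x y T(1) by (intro exI[of _ x] exI[of _ y]) (auto simp: bij_betw_def)
  qed
  then show ?thesis unfolding weakly_sum_free_mod_def by blast
qed

lemma card_filter_split:
  assumes "finite A"
  shows "card {x\<in>A. Q x} + card {x\<in>A. \<not> Q x} = card A"
proof -
  have "card ({x\<in>A. Q x} \<union> {x\<in>A. \<not> Q x}) = card {x\<in>A. Q x} + card {x\<in>A. \<not> Q x}"
    using assms by (intro card_Un_disjoint) auto
  moreover have "{x\<in>A. Q x} \<union> {x\<in>A. \<not> Q x} = A" by auto
  ultimately show ?thesis by simp
qed

text \<open>
  Deleting two elements of different parities in turn from a set of \<open>l + 2\<close> elements leaves two sets
  of \<open>l + 1\<close> elements whose numbers of odd elements differ by one, so they are not both odd.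
\<close>

lemma same_parity_if_weakly_sum_free_mod_2:
  assumes sf: "weakly_sum_free_mod 2 l A" and card: "card A \<ge> l + 2"
    and "x \<in> A" "y \<in> A"
  shows "odd x \<longleftrightarrow> odd y"
proof (rule ccontr)
  assume "\<not> ?thesis"
  then obtain u v where uv: "u \<in> A" "v \<in> A" "odd u" "even v"
    using assms by metis
  then have ne: "u \<noteq> v" by auto
  have fin: "finite A" using card by (intro card_ge_0_finite) simp
  have "l \<le> card (A - {u, v})"
    using card uv ne fin by (simp add: card_Diff_subset)
  then obtain B where B: "B \<subseteq> A - {u, v}" "card B = l" "finite B"
    using obtain_subset_with_card_n by metis
  have "odd (card {x\<in>T. odd x})" if "T \<subseteq> A" "card T = l + 1" for T
    using sf that unfolding weakly_sum_free_mod_2_iff_subsets by blast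
  moreover have "insert u B \<subseteq> A" "insert v B \<subseteq> A" "card (insert u B) = l + 1"
    "card (insert v B) = l + 1"
    using B uv by (auto simp: card_insert_if)
  ultimately have "odd (card {x\<in>insert u B. odd x})" "odd (card {x\<in>insert v B. odd x})"
    by blast+
  moreover have "{x\<in>insert u B. odd x} = insert u {x\<in>B. odd x}" "u \<notin> {x\<in>B. odd x}"
    "{x\<in>insert v B. odd x} = {x\<in>B. odd x}" using uv B by auto
  moreover from this have "card {x\<in>insert u B. odd x} = Suc (card {x\<in>B. odd x})"
    using B(3) by (metis card_insert_disjoint finite_Collect_conjI Collect_mem_eq)
  ultimately show False by (metis even_Suc)
qed

lemma weakly_sum_free_mod_2_iff:
  assumes fin: "finite A"
  shows "weakly_sum_free_mod 2 l A \<longleftrightarrow>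
    card A \<le> l \<or> (card A = l + 1 \<and> odd (card {x\<in>A. odd x})) \<or> (even l \<and> (\<forall>x\<in>A. odd x))"
    (is "_ \<longleftrightarrow> ?R")
proof
  assume sf: "weakly_sum_free_mod 2 l A"
  consider "card A \<le> l" | "card A = l + 1" | "card A \<ge> l + 2" by linarith
  then show ?R
  proof cases
    case 2
    then show ?thesis using sf by (auto simp: weakly_sum_free_mod_2_iff_subsets)
  next
    case 3
    then obtain T where T: "T \<subseteq> A" "card T = l + 1"
      using obtain_subset_with_card_n[of "l + 1" A] by auto
    then have odd: "odd (card {x\<in>T. odd x})"
      using sf by (auto simp: weakly_sum_free_mod_2_iff_subsets)
    then have "{x\<in>T. odd x} \<noteq> {}" by fastforce
    then have all: "\<forall>x\<in>A. odd x"
      using same_parity_if_weakly_sum_free_mod_2[OF sf 3] T by blast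
    then have "{x\<in>T. odd x} = T" using T by auto
    then show ?thesis using odd T all by simp
  qed simp
next
  assume R: ?R
  show "weakly_sum_free_mod 2 l A"
    unfolding weakly_sum_free_mod_2_iff_subsets
  proof (intro allI impI)
    fix T assume T: "T \<subseteq> A" "card T = l + 1"
    have le: "card T \<le> card A" using card_mono[OF fin T(1)] .
    show "odd (card {x\<in>T. odd x})"
    proof (cases "even l \<and> (\<forall>x\<in>A. odd x)")
      case True
      then have "{x\<in>T. odd x} = T" using T by auto
      then show ?thesis using T True by simp
    next
      case False
      then have "card A = l + 1" "odd (card {x\<in>A. odd x})" using R T le by auto
      moreover from this have "T = A" using T fin by (simp add: card_subset_eq)
      ultimately show ?thesis by simp
    qed
  qed
qed

lemma card_le_if_weakly_sum_free_mod_2: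
  assumes "weakly_sum_free_mod 2 l A" "finite A" "odd l \<or> (\<exists>x\<in>A. even x)"
  shows "card A \<le> l + 1"
  using assms by (auto simp: weakly_sum_free_mod_2_iff)

lemma odd_card_odd_if_full:
  assumes "weakly_sum_free_mod 2 l A" "finite A" "card A = l + 1"
  shows "odd (card {x\<in>A. odd x})"
  using assms by (auto simp: weakly_sum_free_mod_2_iff_subsets)

lemma card_even_le_if_weakly_sum_free_mod_2:
  assumes sf: "weakly_sum_free_mod 2 l A" and fin: "finite A"
  shows "card {x\<in>A. even x} \<le> l"
proof (cases "\<forall>x\<in>A. odd x")
  case True
  then have "{x\<in>A. even x} = {}" by auto
  then show ?thesis by (metis card.empty le0)
next
  case False
  then have "card A \<le> l \<or> card A = l + 1 \<and> odd (card {x\<in>A. odd x})"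
    using sf unfolding weakly_sum_free_mod_2_iff[OF fin] by blast
  then show ?thesis
    using card_filter_split[OF fin, of even] odd_pos[of "card {x\<in>A. odd x}"] by linarith
qed

lemma finite_interval_filter [simp]:
  fixes a b :: int
  shows "finite {x. a \<le> x \<and> x \<le> b \<and> Q x}"
  by (rule finite_subset[of _ "{a..b}"]) auto

lemma card_odd_interval:
  fixes a :: int
  assumes "even a"
  shows "card {x\<in>{a + 1..a + int m}. odd x} = (m + 1) div 2"
proof (induction m)
  case (Suc m)
  have split: "{x\<in>{a + 1..a + int (Suc m)}. odd x} =
      {x\<in>{a + 1..a + int m}. odd x} \<union> (if even m then {a + int (Suc m)} else {})"
    using assms by (auto, presburger+)
  show ?case
    unfolding split using Suc by (subst card_Un_disjoint) auto
qed simp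

section \<open>Building partitions\<close>

definition sum_free_partitionable :: "nat \<Rightarrow> nat \<Rightarrow> int set \<Rightarrow> bool" where
  "sum_free_partitionable k l S \<longleftrightarrow>
     (\<exists>P. is_k_partition k S P \<and> (\<forall>i\<in>{1..k}. weakly_sum_free_mod 2 l (P i)))"

lemma sum_free_partitionable_empty: "sum_free_partitionable 0 l {}"
  by (simp add: sum_free_partitionable_def is_k_partition_def)

lemma sum_free_partitionable_Un:
  assumes "sum_free_partitionable k l S" "weakly_sum_free_mod 2 l T" "S \<inter> T = {}"
  shows "sum_free_partitionable (Suc k) l (S \<union> T)"
proof -
  obtain P where P: "is_k_partition k S P" "\<forall>i\<in>{1..k}. weakly_sum_free_mod 2 l (P i)"
    using assms by (auto simp: sum_free_partitionable_def)
  let ?P = "P(Suc k := T)"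
  have sub: "\<forall>i\<in>{1..k}. P i \<subseteq> S" and ex1: "\<forall>s\<in>S. \<exists>!i. i \<in> {1..k} \<and> s \<in> P i"
    using P(1) by (auto simp: is_k_partition_def)
  have "\<exists>!i. i \<in> {1..Suc k} \<and> s \<in> ?P i" if s: "s \<in> S \<union> T" for s
  proof (cases "s \<in> T")
    case True
    then have "s \<notin> S" using assms by auto
    then have "i = Suc k" if "i \<in> {1..Suc k}" "s \<in> ?P i" for i
      using that sub by (cases "i = Suc k") (auto simp: le_Suc_eq)
    then show ?thesis using True by (intro ex1I[of _ "Suc k"]) auto
  next
    case False
    then obtain i where i: "i \<in> {1..k}" "s \<in> P i" "\<And>j. j \<in> {1..k} \<Longrightarrow> s \<in> P j \<Longrightarrow> j = i"
      using ex1 s by (metis UnE)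
    show ?thesis
    proof (intro ex1I[of _ i])
      show "i \<in> {1..Suc k} \<and> s \<in> ?P i" using i(1,2) by auto
      show "j = i" if "j \<in> {1..Suc k} \<and> s \<in> ?P j" for j
      proof (rule i(3))
        show "j \<in> {1..k}" "s \<in> P j" using that False by (auto simp: le_Suc_eq split: if_splits)
      qed
    qed
  qed
  then have "is_k_partition (Suc k) (S \<union> T) ?P"
    using sub unfolding is_k_partition_def by (auto simp: le_Suc_eq)
  moreover have "\<forall>i\<in>{1..Suc k}. weakly_sum_free_mod 2 l (?P i)"
    using P assms by (auto simp: le_Suc_eq)
  ultimately show ?thesis unfolding sum_free_partitionable_def by blast
qed

lemma sum_free_partitionable_append_block:
  assumes "sum_free_partitionable k l {1..int n}"
    and "weakly_sum_free_mod 2 l {int n + 1..int n + int m}"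
  shows "sum_free_partitionable (Suc k) l {1..int (n + m)}"
proof -
  have "{1..int (n + m)} = {1..int n} \<union> {int n + 1..int n + int m}" by auto
  then show ?thesis using assms by (auto intro: sum_free_partitionable_Un)
qed

text \<open>A block of \<open>l + 1\<close> numbers that starts with an odd one has \<open>(l + 2) div 2\<close> odd elements.\<close>

lemma weakly_sum_free_mod_2_block:
  assumes "even a" "odd ((l + 2) div 2)"
  shows "weakly_sum_free_mod 2 l {a + 1..a + int (l + 1)}"
proof -
  have "card {a + 1..a + int (l + 1)} = l + 1" by simp
  moreover have "odd (card {x\<in>{a + 1..a + int (l + 1)}. odd x})"
    using assms card_odd_interval[of a "l + 1"] by simp
  ultimately show ?thesis by (simp only: weakly_sum_free_mod_2_iff finite_atLeastAtMost_int) simp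
qed

lemma weakly_sum_free_mod_2_short_block: "weakly_sum_free_mod 2 l {a + 1..a + int l}"
  by (simp add: weakly_sum_free_mod_2_iff)

lemma sum_free_partitionable_mod4_1:
  assumes "l mod 4 = 1"
  shows "sum_free_partitionable k l {1..int (k * (l + 1))}"
proof (induction k)
  case (Suc k)
  have "even (int (k * (l + 1)))" "odd ((l + 2) div 2)" using assms by (auto, presburger+)
  from sum_free_partitionable_append_block[OF Suc weakly_sum_free_mod_2_block[OF this]]
  show ?case by (simp add: algebra_simps)
qed (simp add: sum_free_partitionable_empty)

text \<open>
  For \<open>l \<equiv> 3 (mod 4)\<close> a block of \<open>l + 1\<close> consecutive numbers has an even number of odd elements.
  Exchanging the last number of a block, which is even, for the first number of the next block,
  which is odd, corrects the parity in both blocks.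
\<close>

lemma sum_free_partitionable_append_two_blocks:
  assumes part: "sum_free_partitionable k l {1..int n}" and n: "even n" and l: "l mod 4 = 3"
  shows "sum_free_partitionable (Suc (Suc k)) l {1..int (n + 2 * (l + 1))}"
proof -
  let ?U = "{int n + 1..int n + int (2 * (l + 1))}"
  let ?B = "{int n + 1..int n + int l}"
  let ?T = "insert (int n + int l + 2) ?B"
  have cardT: "card ?T = l + 1" by simp
  have sub: "?T \<subseteq> ?U" by auto
  have odd_l: "odd l" using l by presburger
  have "{x\<in>?T. odd x} = insert (int n + int l + 2) {x\<in>?B. odd x}"
    using n odd_l by auto
  then have "card {x\<in>?T. odd x} = Suc ((l + 1) div 2)"
    using n card_odd_interval[of "int n" l] by simp
  then have oddT: "odd (card {x\<in>?T. odd x})" using l by presburger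
  have "card {x\<in>?U. odd x} = card ({x\<in>?T. odd x} \<union> {x\<in>?U - ?T. odd x})"
    using sub by (intro arg_cong[of _ _ card]) blast
  also have "\<dots> = card {x\<in>?T. odd x} + card {x\<in>?U - ?T. odd x}"
    by (intro card_Un_disjoint) (simp, simp, blast)
  finally have "card {x\<in>?U. odd x} = card {x\<in>?T. odd x} + card {x\<in>?U - ?T. odd x}" .
  moreover have "even (card {x\<in>?U. odd x})"
    using n odd_l card_odd_interval[of "int n" "2 * (l + 1)"] by simp
  ultimately have oddUT: "odd (card {x\<in>?U - ?T. odd x})"
    using oddT by (simp only: even_add simp_thms)
  have cardUT: "card (?U - ?T) = l + 1"
    using card_Diff_subset[OF _ sub] cardT by simp
  have "sum_free_partitionable (Suc (Suc k)) l (({1..int n} \<union> ?T) \<union> (?U - ?T))"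
    using part cardT oddT cardUT oddUT
    by (intro sum_free_partitionable_Un) (auto simp: weakly_sum_free_mod_2_iff)
  moreover have "({1..int n} \<union> ?T) \<union> (?U - ?T) = {1..int (n + 2 * (l + 1))}"
    by auto
  ultimately show ?thesis by (simp only:)
qed

lemma sum_free_partitionable_mod4_3:
  assumes "l mod 4 = 3"
  shows "sum_free_partitionable (2 * j) l {1..int (2 * j * (l + 1))}"
proof (induction j)
  case (Suc j)
  from sum_free_partitionable_append_two_blocks[OF Suc _ assms]
  show ?case by (simp add: algebra_simps)
qed (simp add: sum_free_partitionable_empty)

lemma sum_free_partitionable_even_numbers:
  "sum_free_partitionable k l {x\<in>{1..int (2 * k * l)}. even x}"
proof (induction k)
  case (Suc k)
  define n where "n = 2 * k * l"
  have n: "even n" "2 * Suc k * l = n + 2 * l" by (simp_all add: n_def algebra_simps)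
  let ?B = "{int n + 1..int n + int (2 * l)}"
  let ?T = "{x\<in>?B. even x}"
  have "card ?T = l"
    using card_filter_split[of ?B odd] card_odd_interval[of "int n" "2 * l"] n by simp
  then have "weakly_sum_free_mod 2 l ?T" by (simp add: weakly_sum_free_mod_2_iff)
  then have "sum_free_partitionable (Suc k) l ({x\<in>{1..int n}. even x} \<union> ?T)"
    using Suc unfolding n_def[symmetric] by (intro sum_free_partitionable_Un) auto
  moreover have "{x\<in>{1..int n}. even x} \<union> ?T = {x\<in>{1..int (2 * Suc k * l)}. even x}"
    unfolding n by auto
  ultimately show ?case by simp
qed (simp add: sum_free_partitionable_empty)

lemma sum_free_partitionable_even:
  assumes "even l"
  shows "sum_free_partitionable (Suc k) l {1..int (2 * k * l + 1)}"
proof -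
  let ?S = "{1..int (2 * k * l + 1)}"
  have "x \<le> int (2 * k * l)" if "even x" "x \<le> int (2 * k * l + 1)" for x
  proof -
    have "x \<noteq> int (2 * k * l + 1)" using that by auto
    then show ?thesis using that by simp
  qed
  then have "{x\<in>{1..int (2 * k * l)}. even x} = {x\<in>?S. even x}" by fastforce
  then have "sum_free_partitionable k l {x\<in>?S. even x}"
    using sum_free_partitionable_even_numbers[of k l] by simp
  moreover have "weakly_sum_free_mod 2 l {x\<in>?S. odd x}"
    using assms by (simp add: weakly_sum_free_mod_2_iff)
  ultimately have "sum_free_partitionable (Suc k) l ({x\<in>?S. even x} \<union> {x\<in>?S. odd x})"
    by (intro sum_free_partitionable_Un) auto
  moreover have "{x\<in>?S. even x} \<union> {x\<in>?S. odd x} = ?S" by auto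
  ultimately show ?thesis by simp
qed

section \<open>Upper bounds\<close>

lemma finite_part:
  assumes "is_k_partition k S P" "finite S" "i \<in> {1..k}"
  shows "finite (P i)"
  using assms finite_subset unfolding is_k_partition_def by blast

lemma card_filter_eq_sum_parts:
  assumes P: "is_k_partition k S P" and fin: "finite S"
  shows "card {x\<in>S. Q x} = (\<Sum>i=1..k. card {x\<in>P i. Q x})"
proof -
  have union: "{x\<in>S. Q x} = (\<Union>i\<in>{1..k}. {x\<in>P i. Q x})"
    using P unfolding is_k_partition_def by blast
  have disj: "P i \<inter> P j = {}" if "i \<in> {1..k}" "j \<in> {1..k}" "i \<noteq> j" for i j
    using P that unfolding is_k_partition_def by blast
  have "card (\<Union>i\<in>{1..k}. {x\<in>P i. Q x}) = (\<Sum>i=1..k. card {x\<in>P i. Q x})"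
  proof (intro card_UN_disjoint ballI impI)
    show "finite {x\<in>P i. Q x}" if "i \<in> {1..k}" for i
      using finite_part[OF P fin that] by simp
    show "{x\<in>P i. Q x} \<inter> {x\<in>P j. Q x} = {}" if "i \<in> {1..k}" "j \<in> {1..k}" "i \<noteq> j" for i j
      using disj[OF that] by blast
  qed simp
  then show ?thesis using union by simp
qed

text \<open>
  If all parts have at most \<open>l + 1\<close> elements and equality holds in the resulting bound, then every
  part is full and contributes an odd number to the total of \<open>(n + 1) div 2\<close> odd elements.
\<close>

lemma bound_if_all_parts_small:
  assumes P: "is_k_partition k {1..int n} P"
    and sf: "\<forall>i\<in>{1..k}. weakly_sum_free_mod 2 l (P i)"
    and small: "\<forall>i\<in>{1..k}. card (P i) \<le> l + 1"
  shows "n \<le> k * (l + 1)"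
    and "n = k * (l + 1) \<Longrightarrow> even ((n + 1) div 2) \<longleftrightarrow> even k"
proof -
  have fin: "\<forall>i\<in>{1..k}. finite (P i)"
    using finite_part[OF P] by simp
  have n: "n = (\<Sum>i=1..k. card (P i))"
    using card_filter_eq_sum_parts[OF P, of "\<lambda>_. True"]
    by (simp only: simp_thms Collect_mem_eq card_atLeastAtMost_int finite_atLeastAtMost_int) simp
  also have "\<dots> \<le> (\<Sum>i=1..k. l + 1)" using small by (intro sum_mono) auto
  finally show "n \<le> k * (l + 1)" by simp
  assume eq: "n = k * (l + 1)"
  have full: "card (P i) = l + 1" if i: "i \<in> {1..k}" for i
  proof (rule ccontr)
    assume "card (P i) \<noteq> l + 1"
    then have "card (P i) < l + 1" using small i by (simp add: le_neq_trans)
    then have "(\<Sum>i=1..k. card (P i)) < (\<Sum>i=1..k. l + 1)"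
      using small i by (intro sum_strict_mono_ex1) auto
    then show False using n eq by simp
  qed
  have "(n + 1) div 2 = (\<Sum>i=1..k. card {x\<in>P i. odd x})"
    using card_filter_eq_sum_parts[OF P, of odd] card_odd_interval[of 0 n] by simp
  moreover have "{i\<in>{1..k}. odd (card {x\<in>P i. odd x})} = {1..k}"
    using full sf fin odd_card_odd_if_full by blast
  ultimately show "even ((n + 1) div 2) \<longleftrightarrow> even k"
    by (simp add: even_sum_iff)
qed

text \<open>
  Both alternatives in the second assumption rule out a large part consisting of odd numbers: for
  odd \<open>l\<close> such a part is not sum-free, and a single part has to contain the number \<open>2\<close>.
\<close>

lemma bound_if_odd_or_single_part:
  assumes part: "sum_free_partitionable k l {1..int n}"
    and "odd l \<or> (k = 1 \<and> n \<ge> 2)"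
  shows "n \<le> k * (l + 1)"
    and "n = k * (l + 1) \<Longrightarrow> even ((n + 1) div 2) \<longleftrightarrow> even k"
proof -
  obtain P where P: "is_k_partition k {1..int n} P"
    and sf: "\<forall>i\<in>{1..k}. weakly_sum_free_mod 2 l (P i)"
    using part by (auto simp: sum_free_partitionable_def)
  have small: "\<forall>i\<in>{1..k}. card (P i) \<le> l + 1"
  proof
    fix i assume i: "i \<in> {1..k}"
    have two: "2 \<in> P i" if "k = 1" "n \<ge> 2"
    proof -
      have "2 \<in> {1..int n}" using that by simp
      then have "\<exists>!i. i \<in> {1..k} \<and> 2 \<in> P i" using P unfolding is_k_partition_def by blast
      then obtain j where "j \<in> {1..k}" "2 \<in> P j" by blast
      then show ?thesis using that i by (metis atLeastAtMost_singleton singletonD)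
    qed
    have "odd l \<or> (\<exists>x\<in>P i. even x)"
      using assms(2) two bexI[of even 2 "P i"] by auto
    moreover have "finite (P i)" using finite_part[OF P] i by simp
    ultimately show "card (P i) \<le> l + 1"
      using sf i card_le_if_weakly_sum_free_mod_2 by blast
  qed
  show "n \<le> k * (l + 1)" "n = k * (l + 1) \<Longrightarrow> even ((n + 1) div 2) \<longleftrightarrow> even k"
    using bound_if_all_parts_small[OF P sf small] by auto
qed

text \<open>
  A part without even elements leaves \<open>k - 1\<close> parts for the \<open>n div 2\<close> even numbers, and each of
  them takes at most \<open>l\<close>. Without such a part the bound \<open>k (l + 1)\<close> applies, which is larger
  than the claimed one only if \<open>k = 2\<close>; then \<open>n = 2 (l + 1)\<close>, and \<open>l + 1\<close> odd numbers would have to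
  be the union of two parts with an odd number of odd elements each, although \<open>l + 1\<close> is odd.
\<close>

lemma bound_even:
  assumes part: "sum_free_partitionable k l {1..int n}"
    and l: "even l" "l \<ge> 1" and k: "k \<ge> 2"
  shows "n \<le> 2 * (k - 1) * l + 1"
proof (rule ccontr)
  assume "\<not> ?thesis"
  then have n: "n \<ge> 2 * (k - 1) * l + 2" by simp
  obtain P where P: "is_k_partition k {1..int n} P"
    and sf: "\<forall>i\<in>{1..k}. weakly_sum_free_mod 2 l (P i)"
    using part by (auto simp: sum_free_partitionable_def)
  have fin: "\<forall>i\<in>{1..k}. finite (P i)"
    using finite_part[OF P] by simp
  show False
  proof (cases "\<exists>j\<in>{1..k}. \<forall>x\<in>P j. odd x")
    case True
    then obtain j where j: "j \<in> {1..k}" "\<forall>x\<in>P j. odd x" by blast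
    have "card {x\<in>{1..int n}. even x} = (\<Sum>i=1..k. card {x\<in>P i. even x})"
      using card_filter_eq_sum_parts[OF P] by simp
    also have "\<dots> = card {x\<in>P j. even x} + (\<Sum>i\<in>{1..k} - {j}. card {x\<in>P i. even x})"
      using j by (intro sum.remove) auto
    also have "{x\<in>P j. even x} = {}" using j by auto
    also have "card {} + (\<Sum>i\<in>{1..k} - {j}. card {x\<in>P i. even x}) \<le> (\<Sum>i\<in>{1..k} - {j}. l)"
    proof -
      have "card {x\<in>P i. even x} \<le> l" if "i \<in> {1..k} - {j}" for i
        using that sf fin by (intro card_even_le_if_weakly_sum_free_mod_2) auto
      then have "(\<Sum>i\<in>{1..k} - {j}. card {x\<in>P i. even x}) \<le> (\<Sum>i\<in>{1..k} - {j}. l)"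
        by (rule sum_mono)
      then show ?thesis by simp
    qed
    also have "\<dots> = (k - 1) * l" using j by simp
    finally have "card {x\<in>{1..int n}. even x} \<le> (k - 1) * l" .
    moreover have "card {x\<in>{1..int n}. even x} = n div 2"
      using card_filter_split[of "{1..int n}" even] card_odd_interval[of 0 n] by simp
    ultimately show False using n by linarith
  next
    case False
    then have small: "\<forall>i\<in>{1..k}. card (P i) \<le> l + 1"
      using sf fin card_le_if_weakly_sum_free_mod_2 by blast
    note bound = bound_if_all_parts_small[OF P sf small]
    obtain q where q: "k = q + 2" using k by (metis le_add_diff_inverse2)
    obtain r where r: "l = Suc (Suc r)" using l by (cases l; cases "l - 1") auto
    \<comment> \<open>In terms of \<open>q = k - 2\<close> and \<open>r = l - 2\<close> the next inequality reads \<open>q (r + 1) \<le> 0\<close>.\<close>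
    have "2 * (k - 1) * l + 2 \<le> k * (l + 1)" using n bound(1) by linarith
    then have "q = 0" by (simp add: q r algebra_simps)
    then have k2: "k = 2" using q by simp
    then have "n = 2 * (l + 1)" using n bound(1) by simp
    then show False using bound(2) k2 l by simp
  qed
qed

lemma WS_2_eqI:
  assumes "sum_free_partitionable k l {1..int N}"
    and "\<And>n. sum_free_partitionable k l {1..int n} \<Longrightarrow> n \<le> N"
  shows "WS 2 k l = N"
  unfolding WS_def sum_free_partitionable_def[symmetric]
  using assms by (intro Greatest_equality) auto

section \<open>The generalized weak Schur numbers modulo two\<close>

theorem theorem1p3:
  fixes k l :: nat
  assumes "k \<ge> 1" and "l \<ge> 1"
  shows
    "(k = 1 \<and> ([l = 0] (mod 4) \<or> [l = 1] (mod 4)) \<longrightarrow> WS 2 k l = l + 1) \<and>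
     (k = 1 \<and> ([l = 2] (mod 4) \<or> [l = 3] (mod 4)) \<longrightarrow> WS 2 k l = l) \<and>
     (k \<ge> 2 \<and> even l \<longrightarrow> WS 2 k l = 2 * (k - 1) * l + 1) \<and>
     (k \<ge> 2 \<and> [l = 1] (mod 4) \<longrightarrow> WS 2 k l = k * (l + 1)) \<and>
     (k \<ge> 2 \<and> even k \<and> [l = 3] (mod 4) \<longrightarrow> WS 2 k l = k * (l + 1)) \<and>
     (k \<ge> 3 \<and> odd k \<and> [l = 3] (mod 4) \<longrightarrow> WS 2 k l = k * (l + 1) - 1)"
proof (intro conjI impI; elim conjE)
  assume k: "k = 1" and l: "[l = 0] (mod 4) \<or> [l = 1] (mod 4)"
  have "odd ((l + 2) div 2)" using l unfolding cong_def by presburger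
  then have "weakly_sum_free_mod 2 l {int 0 + 1..int 0 + int (l + 1)}"
    by (intro weakly_sum_free_mod_2_block) auto
  then have "sum_free_partitionable (Suc 0) l {1..int (0 + (l + 1))}"
    by (intro sum_free_partitionable_append_block) (auto simp: sum_free_partitionable_empty)
  moreover have n_le: "n \<le> l + 1" if "sum_free_partitionable 1 l {1..int n}" for n
  proof (cases "n \<ge> 2")
    case True
    then show ?thesis using bound_if_odd_or_single_part(1)[OF that] by simp
  qed simp
  ultimately show "WS 2 k l = l + 1"
    using k by (intro WS_2_eqI) (simp_all add: n_le)
next
  assume k: "k = 1" and l: "[l = 2] (mod 4) \<or> [l = 3] (mod 4)"
  have "sum_free_partitionable (Suc 0) l {1..int (0 + l)}"
    using weakly_sum_free_mod_2_short_block[of l "int 0"]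
    by (intro sum_free_partitionable_append_block) (auto simp: sum_free_partitionable_empty)
  moreover have "n \<le> l" if part: "sum_free_partitionable 1 l {1..int n}" for n
  proof (rule ccontr)
    assume "\<not> n \<le> l"
    then have "n \<ge> 2" using \<open>l \<ge> 1\<close> by simp
    then have n: "n = l + 1" and "even ((n + 1) div 2) \<longleftrightarrow> even (1::nat)"
      using bound_if_odd_or_single_part[OF part] \<open>\<not> n \<le> l\<close> by simp_all
    then have "odd ((l + 2) div 2)" by simp
    moreover have "l mod 4 = 2 \<or> l mod 4 = 3" using l by (simp add: cong_def)
    ultimately show False by presburger
  qed
  ultimately show "WS 2 k l = l" using k by (intro WS_2_eqI) simp_all
next
  assume "k \<ge> 2" "even l"
  then show "WS 2 k l = 2 * (k - 1) * l + 1"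
    using sum_free_partitionable_even[of l "k - 1"] bound_even \<open>l \<ge> 1\<close>
    by (intro WS_2_eqI) simp_all
next
  assume "[l = 1] (mod 4)"
  then have l: "l mod 4 = 1" by (simp add: cong_def)
  then have "odd l" by presburger
  then show "WS 2 k l = k * (l + 1)"
    using sum_free_partitionable_mod4_1[OF l] bound_if_odd_or_single_part(1) by (intro WS_2_eqI) auto
next
  assume "even k" "[l = 3] (mod 4)"
  then have l: "l mod 4 = 3" by (simp add: cong_def)
  then have "odd l" by presburger
  moreover obtain j where "k = 2 * j" using \<open>even k\<close> by blast
  ultimately show "WS 2 k l = k * (l + 1)"
    using sum_free_partitionable_mod4_3[OF l, of j] bound_if_odd_or_single_part(1)
    by (intro WS_2_eqI) auto
next
  assume k: "odd k" and "[l = 3] (mod 4)"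
  then have l: "l mod 4 = 3" by (simp add: cong_def)
  then have odd: "odd l" by presburger
  obtain j where j: "k = Suc (2 * j)" using k by (metis oddE Suc_eq_plus1)
  have "sum_free_partitionable (Suc (2 * j)) l {1..int (2 * j * (l + 1) + l)}"
    by (intro sum_free_partitionable_append_block sum_free_partitionable_mod4_3 l
        weakly_sum_free_mod_2_short_block)
  moreover have "2 * j * (l + 1) + l = k * (l + 1) - 1" using j by simp
  ultimately have part: "sum_free_partitionable k l {1..int (k * (l + 1) - 1)}"
    by (simp only: j)
  have "n \<le> k * (l + 1) - 1" if part: "sum_free_partitionable k l {1..int n}" for n
  proof -
    note bound = bound_if_odd_or_single_part[OF part]
    have "n \<noteq> k * (l + 1)"
    proof
      assume n: "n = k * (l + 1)"
      have "4 dvd l + 1" using l by presburger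
      then obtain q where "l + 1 = 4 * q" by blast
      then have "even ((n + 1) div 2)" by (simp add: n)
      then show False using bound(2) n odd k by blast
    qed
    then show ?thesis using bound(1) odd by simp
  qed
  with part show "WS 2 k l = k * (l + 1) - 1"
    by (rule WS_2_eqI)
qed

end
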